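(* Let $\mathsf{AP}$ be any finite set of atomic propositions. Then the concept class $(\mathsf{LTL}[\mathsf{AP}],\mathcal{W}^{\mathsf{fin}},\varphi\mapsto[\![\varphi]\!]\cap\mathcal{W}^{\mathsf{fin}})$ has characteristic samples; i.e. $\mathsf{LTL}[\mathsf{AP}]$ admits characteristic samples over $\mathcal{W}^{\mathsf{fin}}$.
   Context: $\mathcal{W}^{\mathsf{fin}}$ is the set of finite words over $2^{\mathsf{AP}}$. LTL syntax: $\varphi::=\top\mid p\mid\neg\varphi\mid\varphi\land\varphi\mid\mathsf{X}\varphi\mid\mathsf{F}\varphi\mid\varphi\,\mathsf{U}\,\varphi$, $p\in\mathsf{AP}$; semantics on a finite word $w$ with suffixes $w[i..]$: $w\models\top$; $w\models p$ iff $p\in w[0]$; $\neg,\land$ as usual; $w\models\mathsf{X}\varphi$ iff $|w|>1$ and $w[1..]\models\varphi$; $w\models\mathsf{F}\varphi$ iff some $i<|w|$ has $w[i..]\models\varphi$; $w\models\varphi\,\mathsf{U}\,\psi$ iff some $j<|w|$ has $w[j..]\models\psi$ and $w[i..]\models\varphi$ for all $i<j$. A concept class $(\Psi,\mathcal{X},[\![\cdot]\!])$ has concepts $\Psi$, instances $\mathcal{X}$, and $[\![\psi]\!]\subseteq\mathcal{X}$. A sample is a finite subset of $\mathcal{X}\times\{0,1\}$; $\psi$ fits $S$ if for all $(x,b)\in S$, $x\in[\![\psi]\!]$ iff $b=1$. A learner is a function $L$ from finite samples to $\Psi$ with $L(S)$ fitting $S$ whenever $S$ fits some element of $\Psi$;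 a teacher is a function $T$ from $\Psi$ to finite samples with $T(\psi)$ fitting $\psi$ (neither need be computable). $S$ is a characteristic sample for $\psi$ and $L$ if $S$ fits $\psi$ and for every sample $S'\supseteq S$ fitting $\psi$, $[\![L(S')]\!]=[\![\psi]\!]$. The class has characteristic samples if for some learner $L$ there is a teacher $T$ with $T(\psi)$ a characteristic sample for $\psi$ and $L$ for every $\psi\in\Psi$. *)

theory Defs
  imports Main "HOL-Library.FuncSet"
begin

section \<open>LTL on finite words\<close>

datatype (atoms: 'a) ltl =
    Top
  | Atom 'a
  | Not "'a ltl"
  | And "'a ltl" "'a ltl"
  | Next "'a ltl"
  | Finally "'a ltl"
  | Until "'a ltl" "'a ltl"

definition LTL :: "'a set \<Rightarrow> 'a ltl set" where
  "LTL AP = {\<phi>. atoms \<phi> \<subseteq> AP}"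

definition Wfin :: "'a set \<Rightarrow> 'a set list set" where
  "Wfin AP = lists (Pow AP)"

text \<open>The suffix of \<open>w\<close> from position \<open>i\<close> is \<open>drop i w\<close>. The set of finite words contains
  the empty word, which has no first letter; no atom holds there.\<close>

fun sat :: "'a set list \<Rightarrow> 'a ltl \<Rightarrow> bool" where
  "sat w Top = True"
| "sat w (Atom p) = (w \<noteq> [] \<and> p \<in> w ! 0)"
| "sat w (Not \<phi>) = (\<not> sat w \<phi>)"
| "sat w (And \<phi> \<psi>) = (sat w \<phi> \<and> sat w \<psi>)"
| "sat w (Next \<phi>) = (length w > 1 \<and> sat (drop 1 w) \<phi>)"
| "sat w (Finally \<phi>) = (\<exists>i < length w. sat (drop i w) \<phi>)"
| "sat w (Until \<phi> \<psi>) =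
    (\<exists>j < length w. sat (drop j w) \<psi> \<and> (\<forall>i < j. sat (drop i w) \<phi>))"

definition lang :: "'a ltl \<Rightarrow> 'a set list set" where
  "lang \<phi> = {w. sat w \<phi>}"


section \<open>Concept classes and characteristic samples\<close>

text \<open>A concept class is given by a set \<open>C\<close> of concepts, a set \<open>X\<close> of instances, and the
  extension \<open>ext\<close> of each concept. Labels 0 and 1 are Boolean values.\<close>

definition concept_class :: "'c set \<Rightarrow> 'x set \<Rightarrow> ('c \<Rightarrow> 'x set) \<Rightarrow> bool" where
  "concept_class C X ext \<longleftrightarrow> (\<forall>c \<in> C. ext c \<subseteq> X)"

definition samples :: "'x set \<Rightarrow> ('x \<times> bool) set set" where
  "samples X = {S. finite S \<and> S \<subseteq> X \<times> UNIV}"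

definition fits :: "('c \<Rightarrow> 'x set) \<Rightarrow> 'c \<Rightarrow> ('x \<times> bool) set \<Rightarrow> bool" where
  "fits ext c S \<longleftrightarrow> (\<forall>(x, b) \<in> S. x \<in> ext c \<longleftrightarrow> b)"

definition learner ::
  "'c set \<Rightarrow> 'x set \<Rightarrow> ('c \<Rightarrow> 'x set) \<Rightarrow> (('x \<times> bool) set \<Rightarrow> 'c) \<Rightarrow> bool" where
  "learner C X ext L \<longleftrightarrow>
     L \<in> samples X \<rightarrow> C \<and>
     (\<forall>S \<in> samples X. (\<exists>c \<in> C. fits ext c S) \<longrightarrow> fits ext (L S) S)"

definition teacher ::
  "'c set \<Rightarrow> 'x set \<Rightarrow> ('c \<Rightarrow> 'x set) \<Rightarrow> ('c \<Rightarrow> ('x \<times> bool) set) \<Rightarrow> bool" where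
  "teacher C X ext T \<longleftrightarrow>
     T \<in> C \<rightarrow> samples X \<and> (\<forall>c \<in> C. fits ext c (T c))"

definition characteristic_sample ::
  "'x set \<Rightarrow> ('c \<Rightarrow> 'x set) \<Rightarrow> (('x \<times> bool) set \<Rightarrow> 'c) \<Rightarrow> 'c \<Rightarrow> ('x \<times> bool) set \<Rightarrow> bool" where
  "characteristic_sample X ext L c S \<longleftrightarrow>
     S \<in> samples X \<and> fits ext c S \<and>
     (\<forall>S' \<in> samples X. S \<subseteq> S' \<and> fits ext c S' \<longrightarrow> ext (L S') = ext c)"

definition has_characteristic_samples :: "'c set \<Rightarrow> 'x set \<Rightarrow> ('c \<Rightarrow> 'x set) \<Rightarrow> bool" where
  "has_characteristic_samples C X ext \<longleftrightarrow>
     (\<exists>L. learner C X ext L \<and>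
        (\<exists>T. teacher C X ext T \<and> (\<forall>c \<in> C. characteristic_sample X ext L c (T c))))"

lemma concept_class_LTL: "concept_class (LTL AP) (Wfin AP) (\<lambda>\<phi>. lang \<phi> \<inter> Wfin AP)"
  by (simp add: concept_class_def)

end

(* Identification by enumeration: the learner returns the first concept, in a fixed enumeration of
   the class, that fits the sample. The teacher separates the target from each of the finitely many
   earlier concepts with a different extension. Hence only countability of the class matters. *)
theory Submission
  imports Defs "HOL-Library.Countable_Set"
begin

lemma countable_has_characteristic_samples:
  assumes cc: "concept_class C X ext" and cnt: "countable C" and ne: "C \<noteq> {}"
  shows "has_characteristic_samples C X ext"
proof -
  \<comment> \<open>If \<open>C\<close> is finite, \<open>e\<close> repeats an element of
    \<open>C\<close> beyond the range of \<open>to_nat_on C\<close>, so every index still names a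
    concept.\<close>
  define e where "e = from_nat_into C"
  \<comment> \<open>On a sample that no concept fits, \<open>LEAST\<close> is unspecified, yet the
    value of \<open>L\<close> stays in \<open>C\<close>.\<close>
  define L where "L S = e (LEAST n. fits ext (e n) S)" for S
  define d where "d c c' = (SOME x. x \<in> X \<and> (x \<in> ext c) \<noteq> (x \<in> ext c'))" for c c'
  define T where
    "T c = (\<lambda>n. (d c (e n), d c (e n) \<in> ext c)) ` {n. n < to_nat_on C c \<and> ext (e n) \<noteq> ext c}" for c
  have e_in: "e n \<in> C" for n
    unfolding e_def using ne by (rule from_nat_into)
  have e_to_nat: "e (to_nat_on C c) = c" if "c \<in> C" for c
    unfolding e_def using cnt that by (rule from_nat_into_to_nat_on)
  have d: "d c c' \<in> X \<and> (d c c' \<in> ext c) \<noteq> (d c c' \<in> ext c')"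
    if "c \<in> C" "c' \<in> C" "ext c \<noteq> ext c'" for c c'
  proof -
    \<comment> \<open>Extensions lie inside \<open>X\<close>, so two different ones already differ
      at an instance.\<close>
    have "\<exists>x. x \<in> X \<and> (x \<in> ext c) \<noteq> (x \<in> ext c')"
      using that cc unfolding concept_class_def by blast
    then show ?thesis
      unfolding d_def by (rule someI_ex)
  qed
  have L_fits: "fits ext (L S) S" if "c \<in> C" "fits ext c S" for c S
    unfolding L_def by (rule LeastI[of _ "to_nat_on C c"]) (simp add: e_to_nat that)
  have "learner C X ext L"
    unfolding learner_def using L_fits e_in by (auto simp: L_def)
  have T_samples: "T c \<in> samples X" if "c \<in> C" for c
    unfolding samples_def T_def using d[OF that e_in] by fastforce
  have T_fits: "fits ext c (T c)" for c
    by (auto simp: fits_def T_def)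
  have L_ext: "ext (L S) = ext c" if "c \<in> C" "T c \<subseteq> S" "fits ext c S" for c S
  proof (rule ccontr)
    assume neq: "ext (L S) \<noteq> ext c"
    define n where "n = (LEAST n. fits ext (e n) S)"
    have L_eq: "L S = e n"
      by (simp add: L_def n_def)
    \<comment> \<open>The target fits \<open>S\<close> at its own index, so the search stops there
      at the latest; stopping exactly there would return \<open>c\<close> itself.\<close>
    have "n \<le> to_nat_on C c"
      unfolding n_def by (rule Least_le) (simp add: e_to_nat that)
    moreover have "n \<noteq> to_nat_on C c"
      using neq e_to_nat[OF \<open>c \<in> C\<close>] L_eq by metis
    ultimately have "(d c (e n), d c (e n) \<in> ext c) \<in> T c"
      using neq L_eq by (auto simp: T_def)
    \<comment> \<open>\<open>e n\<close> fits \<open>S\<close>, which contains the example that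
      \<open>T c\<close> holds against it.\<close>
    then have "d c (e n) \<in> ext (e n) \<longleftrightarrow> d c (e n) \<in> ext c"
      using L_fits[OF \<open>c \<in> C\<close> \<open>fits ext c S\<close>] \<open>T c \<subseteq> S\<close> L_eq by (auto simp: fits_def)
    then show False
      using d[OF \<open>c \<in> C\<close> e_in] neq L_eq by metis
  qed
  have "teacher C X ext T" "\<forall>c \<in> C. characteristic_sample X ext L c (T c)"
    unfolding teacher_def characteristic_sample_def using T_samples T_fits L_ext by auto
  with \<open>learner C X ext L\<close> show ?thesis
    unfolding has_characteristic_samples_def by blast
qed

instance ltl :: (countable) countable
  by countable_datatype

text \<open>The type \<open>'a\<close> may be uncountable, so the instance above does not apply to
  it directly. Renaming atoms to naturals embeds \<open>LTL AP\<close> into the countable type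
  \<open>nat ltl\<close>.\<close>

lemma countable_LTL:
  assumes "countable AP"
  shows "countable (LTL AP)"
proof -
  have "inj_on (map_ltl (to_nat_on AP)) (LTL AP)"
  proof (rule inj_onI)
    fix \<phi> \<psi>
    assume "\<phi> \<in> LTL AP" "\<psi> \<in> LTL AP"
      and "map_ltl (to_nat_on AP) \<phi> = map_ltl (to_nat_on AP) \<psi>"
    \<comment> \<open>\<open>to_nat_on AP\<close> is injective only on \<open>AP\<close>, which
      suffices because both formulas take their atoms there.\<close>
    moreover have "p = q"
      if "p \<in> atoms \<phi>" "q \<in> atoms \<psi>" "to_nat_on AP p = to_nat_on AP q" for p q
      using inj_onD[OF inj_on_to_nat_on[OF assms] that(3)] that(1,2)
        \<open>\<phi> \<in> LTL AP\<close> \<open>\<psi> \<in> LTL AP\<close> unfolding LTL_def by blast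
    ultimately show "\<phi> = \<psi>"
      by (metis ltl.inj_map_strong)
  qed
  then show ?thesis
    by (rule countableI')
qed

theorem theorem33:
  fixes AP :: "'a set"
  assumes "finite AP"
  shows "has_characteristic_samples (LTL AP) (Wfin AP) (\<lambda>\<phi>. lang \<phi> \<inter> Wfin AP)"
proof (rule countable_has_characteristic_samples)
  show "countable (LTL AP)"
    using assms by (simp add: countable_LTL countable_finite)
  have "Top \<in> LTL AP"
    by (simp add: LTL_def)
  then show "LTL AP \<noteq> {}"
    by blast
qed (rule concept_class_LTL)

end
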